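(* Let $\mathcal{L}$ be a complex five-dimensional solvable, non-nilpotent, non-split, non-Lie symmetric Leibniz algebra whose underlying Lie algebra is the five-dimensional Lie algebra $\mathcal{G}$ with basis $e_1,\dots,e_5$ and nonzero brackets $[e_1,e_2]=e_1$, $[e_3,e_4]=e_5$ (up to antisymmetry). Then $\mathcal{L}$ is isomorphic to one of the following pairwise non-isomorphic algebras, each of which has brackets $[e_1,e_2]=e_1$, $[e_3,e_4]=e_5$ and the $\circ$-products listed: $\mathcal{L}_{71}^{\alpha}$: $e_3\circ e_4=\alpha e_5$, $e_2\circ e_2=e_5$; $\mathcal{L}_{72}^{\alpha}$: $e_3\circ e_4=\alpha e_5$, $e_2\circ e_4=e_5$; $\mathcal{L}_{73}^{\alpha}$: $e_3\circ e_4=\alpha e_5$, $e_2\circ e_4=e_5$, $e_2\circ e_2=e_5$; $\mathcal{L}_{74}^{\alpha,\beta}$ ($\alpha\neq0$): $e_3\circ e_4=\alpha e_5$, $e_2\circ e_3=e_5$, $e_2\circ e_4=e_5$, $e_2\circ e_2=\beta e_5$; $\mathcal{L}_{75}$: $e_2\circ e_2=e_5$, $e_4\circ e_4=e_5$; $\mathcal{L}_{76}^{\alpha}$: $e_2\circ e_2=\alpha e_5$, $e_2\circ e_3=e_5$, $e_4\circ e_4=e_5$; $\mathcal{L}_{77}^{\alpha}$: $e_2\circ e_2=\alpha e_5$, $e_2\circ e_4=e_5$, $e_4\circ e_4=e_5$; where $\mathcal{L}_{74}^{\alpha,\beta}\cong\mathcal{L}_{74}^{-\alpha,-\beta}$.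
   Context: All algebras are finite-dimensional over $\mathbb{C}$. A symmetric Leibniz algebra is a vector space $\mathcal{L}$ with a bilinear product $\cdot$ satisfying $x\cdot(y\cdot z)=(x\cdot y)\cdot z+y\cdot(x\cdot z)$ and $(x\cdot y)\cdot z=x\cdot(y\cdot z)+(x\cdot z)\cdot y$ for all $x,y,z$. Put $[x,y]=\frac12(x\cdot y-y\cdot x)$ and $x\circ y=\frac12(x\cdot y+y\cdot x)$, so $x\cdot y=[x,y]+x\circ y$; then $(\mathcal{L},[-,-])$ is a Lie algebra, called the underlying Lie algebra. $\mathcal{L}$ is solvable if $\mathcal{L}^{[s]}=0$ for some $s$, where $\mathcal{L}^{[1]}=\mathcal{L}$, $\mathcal{L}^{[s+1]}=\mathcal{L}^{[s]}\cdot\mathcal{L}^{[s]}$; nilpotent if $\mathcal{L}^k=0$ for some $k$, where $\mathcal{L}^1=\mathcal{L}$, $\mathcal{L}^{k+1}=\mathcal{L}^k\cdot\mathcal{L}$. An algebra is split if it is a direct sum of two nonzero ideals; non-Lie means $(\mathcal{L},\cdot)$ is not a Lie algebra (i.e. $\circ\neq0$). Every algebra in the claim has basis $e_1,\dots,e_5$ and is given by its brackets (extended antisymmetrically) and its $\circ$-products (extended symmetrically); all other brackets and $\circ$-products of basis vectors are zero, and $e_i\cdot e_j=[e_i,e_j]+e_i\circ e_j$ (for instance $e_3\cdot e_4=(\alpha+1)e_5$ and $e_4\cdot e_3=(\alpha-1)e_5$ in $\mathcal{L}_{71}^{\alpha}$). Superscripts are complex parameters, arbitrary unless restricted.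
   Formalization: The listed algebras are not pairwise non-isomorphic as claimed: L_71^α ≅ L_71^{-α} via the basis e1, e2, e4, -e3, e5. The formal statement adds this as a second coincidence beside L_74^{α,β} ≅ L_74^{-α,-β} and proves there are no others. *)

theory Defs
  imports "HOL-Analysis.Analysis"
begin

locale complex_algebra = vector_space scale
  for scale :: "complex \<Rightarrow> 'a::ab_group_add \<Rightarrow> 'a" +
  fixes mul :: "'a \<Rightarrow> 'a \<Rightarrow> 'a"
  assumes linear_left: "Vector_Spaces.linear scale scale (\<lambda>x. mul x y)"
    and linear_right: "Vector_Spaces.linear scale scale (\<lambda>y. mul x y)"
begin

definition bracket :: "'a \<Rightarrow> 'a \<Rightarrow> 'a" where
  "bracket x y = scale (1/2) (mul x y - mul y x)"

definition is_lie_algebra :: bool where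
  "is_lie_algebra \<longleftrightarrow>
     (\<forall>x. mul x x = 0) \<and>
     (\<forall>x y z. mul x (mul y z) + mul y (mul z x) + mul z (mul x y) = 0)"

definition mul_sets :: "'a set \<Rightarrow> 'a set \<Rightarrow> 'a set" where
  "mul_sets U V = span {mul u v | u v. u \<in> U \<and> v \<in> V}"

text \<open>Both series are indexed from 0, so that \<open>derived_series s\<close> is the usual
  \<open>L\<^sup>[\<^sup>s\<^sup>+\<^sup>1\<^sup>]\<close> and \<open>lower_series k\<close> is the usual \<open>L\<^sup>k\<^sup>+\<^sup>1\<close>.\<close>

primrec derived_series :: "nat \<Rightarrow> 'a set" where
  "derived_series 0 = UNIV"
| "derived_series (Suc s) = mul_sets (derived_series s) (derived_series s)"

primrec lower_series :: "nat \<Rightarrow> 'a set" where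
  "lower_series 0 = UNIV"
| "lower_series (Suc k) = mul_sets (lower_series k) UNIV"

definition solvable :: bool where
  "solvable \<longleftrightarrow> (\<exists>s. derived_series s = {0})"

definition nilpotent :: bool where
  "nilpotent \<longleftrightarrow> (\<exists>k. lower_series k = {0})"

definition two_sided_ideal :: "'a set \<Rightarrow> bool" where
  "two_sided_ideal I \<longleftrightarrow> subspace I \<and> (\<forall>x. \<forall>i\<in>I. mul x i \<in> I \<and> mul i x \<in> I)"

definition split :: bool where
  "split \<longleftrightarrow> (\<exists>I J. two_sided_ideal I \<and> two_sided_ideal J \<and> I \<noteq> {0} \<and> J \<noteq> {0} \<and>
     I \<inter> J = {0} \<and> (\<forall>x. \<exists>i\<in>I. \<exists>j\<in>J. x = i + j))"

end

locale symmetric_leibniz_algebra = complex_algebra +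
  assumes left_leibniz: "mul x (mul y z) = mul (mul x y) z + mul y (mul x z)"
    and right_leibniz: "mul (mul x y) z = mul x (mul y z) + mul (mul x z) y"

definition isomorphic_algebras ::
  "(complex \<Rightarrow> 'a::ab_group_add \<Rightarrow> 'a) \<Rightarrow> ('a \<Rightarrow> 'a \<Rightarrow> 'a) \<Rightarrow>
   (complex \<Rightarrow> 'b::ab_group_add \<Rightarrow> 'b) \<Rightarrow> ('b \<Rightarrow> 'b \<Rightarrow> 'b) \<Rightarrow> bool" where
  "isomorphic_algebras s1 m1 s2 m2 \<longleftrightarrow>
     (\<exists>f. Vector_Spaces.linear s1 s2 f \<and> bij f \<and> (\<forall>x y. f (m1 x y) = m2 (f x) (f y)))"

text \<open>The concrete algebras live on \<open>complex ^ 5\<close>. In the index type \<open>5\<close> the numeral 5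
  is the same element as 0, so 1, 2, 3, 4, 5 are its five distinct elements.
  A multiplication table is a partial map that lists only the defining nonzero
  products of basis vectors; each unordered pair of indices is listed at most once.\<close>

abbreviation e :: "5 \<Rightarrow> complex ^ 5" where
  "e i \<equiv> axis i 1"

type_synonym table = "5 \<times> 5 \<rightharpoonup> complex ^ 5"

definition antisym_ext :: "table \<Rightarrow> 5 \<Rightarrow> 5 \<Rightarrow> complex ^ 5" where
  "antisym_ext T i j = (case T (i, j) of Some v \<Rightarrow> v | None \<Rightarrow>
     (case T (j, i) of Some v \<Rightarrow> - v | None \<Rightarrow> 0))"

definition sym_ext :: "table \<Rightarrow> 5 \<Rightarrow> 5 \<Rightarrow> complex ^ 5" where
  "sym_ext T i j = (case T (i, j) of Some v \<Rightarrow> v | None \<Rightarrow>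
     (case T (j, i) of Some v \<Rightarrow> v | None \<Rightarrow> 0))"

definition bilinear_ext ::
  "(5 \<Rightarrow> 5 \<Rightarrow> complex ^ 5) \<Rightarrow> complex ^ 5 \<Rightarrow> complex ^ 5 \<Rightarrow> complex ^ 5" where
  "bilinear_ext c x y = (\<Sum>i\<in>UNIV. \<Sum>j\<in>UNIV. (x $ i * y $ j) *s c i j)"

definition lie_table :: table where
  "lie_table = [(1, 2) \<mapsto> e 1, (3, 4) \<mapsto> e 5]"

definition lie_G :: "complex ^ 5 \<Rightarrow> complex ^ 5 \<Rightarrow> complex ^ 5" where
  "lie_G = bilinear_ext (antisym_ext lie_table)"

datatype label =
    L71 complex
  | L72 complex
  | L73 complex
  | L74 complex complex
  | L75
  | L76 complex
  | L77 complex

text \<open>Two coincidences occur among these algebras. Rescaling and exchanging \<open>e 3\<close>, \<open>e 4\<close>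
  identifies \<open>L74 \<alpha> \<beta>\<close> with \<open>L74 (- \<alpha>) (- \<beta>)\<close>. Likewise the new basis
  \<open>e 1, e 2, e 4, - e 3, e 5\<close> preserves the brackets and turns the \<open>\<circ>\<close>-products of
  \<open>L71 \<alpha>\<close> into those of \<open>L71 (- \<alpha>)\<close>. The second one is easily overlooked; without it
  the assertion that the listed algebras are pairwise non-isomorphic is false.\<close>

definition labels :: "label set" where
  "labels = {p. \<forall>\<alpha> \<beta>. p = L74 \<alpha> \<beta> \<longrightarrow> \<alpha> \<noteq> 0}"

fun circ_table :: "label \<Rightarrow> table" where
  "circ_table (L71 \<alpha>) = [(3, 4) \<mapsto> \<alpha> *s e 5, (2, 2) \<mapsto> e 5]"
| "circ_table (L72 \<alpha>) = [(3, 4) \<mapsto> \<alpha> *s e 5, (2, 4) \<mapsto> e 5]"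
| "circ_table (L73 \<alpha>) = [(3, 4) \<mapsto> \<alpha> *s e 5, (2, 4) \<mapsto> e 5, (2, 2) \<mapsto> e 5]"
| "circ_table (L74 \<alpha> \<beta>) =
     [(3, 4) \<mapsto> \<alpha> *s e 5, (2, 3) \<mapsto> e 5, (2, 4) \<mapsto> e 5, (2, 2) \<mapsto> \<beta> *s e 5]"
| "circ_table L75 = [(2, 2) \<mapsto> e 5, (4, 4) \<mapsto> e 5]"
| "circ_table (L76 \<alpha>) = [(2, 2) \<mapsto> \<alpha> *s e 5, (2, 3) \<mapsto> e 5, (4, 4) \<mapsto> e 5]"
| "circ_table (L77 \<alpha>) = [(2, 2) \<mapsto> \<alpha> *s e 5, (2, 4) \<mapsto> e 5, (4, 4) \<mapsto> e 5]"

definition listed_mul :: "label \<Rightarrow> complex ^ 5 \<Rightarrow> complex ^ 5 \<Rightarrow> complex ^ 5" where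
  "listed_mul p =
     bilinear_ext (\<lambda>i j. antisym_ext lie_table i j + sym_ext (circ_table p) i j)"

end

theory Submission
  imports Defs
begin

text \<open>The circle-product of a symmetric Leibniz algebra kills the derived algebra of the underlying Lie
  algebra and takes values in its centre (\<open>circ_bracket\<close>, \<open>bracket_circ\<close>). Over the model Lie
  algebra, with derived algebra \<open>\<langle>e 1, e 5\<rangle>\<close> and centre \<open>\<langle>e 5\<rangle>\<close>, the algebra structure
  therefore amounts to one symmetric bilinear form on \<open>\<langle>e 2, e 3, e 4\<rangle>\<close>
  (\<open>G_isomorphic_cform_mul\<close>).

  Automorphisms of the Lie algebra act on this three-dimensional space by fixing \<open>e 2\<close> and applying
  an invertible 2-by-2 matrix \<open>A\<close> to \<open>\<langle>e 3, e 4\<rangle>\<close>, and they multiply \<open>e 5\<close> by \<open>det A\<close>. So two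
  structures are isomorphic exactly if their forms are congruent under such an \<open>A\<close> up to the factor
  \<open>det A\<close> (\<open>cform_iso_if_cong\<close>, \<open>cong_if_cform_iso\<close>). The theorem thus becomes linear algebra of
  triples: a scalar \<open>b\<close> (the value at \<open>(e 2, e 2)\<close>), a covector \<open>w\<close> and a quadratic form \<open>Q\<close> in two
  variables.

  For existence, \<open>Q\<close> can be brought to \<open>2 \<alpha> X Y\<close> or to \<open>Y\<^sup>2\<close> (\<open>iso_normal_quadratic\<close>); its
  stabilizer then normalizes \<open>w\<close> and finally \<open>b\<close> (\<open>iso_label\<close>). Only \<open>b = 0\<close>, \<open>w = 0\<close> has no
  label, and there the algebra splits (\<open>split_if_e2_circ_zero\<close>). For uniqueness,
  \<open>cong_invariants\<close> provides enough invariants: the vanishing of \<open>b\<close>, \<open>w\<close>, \<open>Q\<close>, the determinant of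
  \<open>Q\<close>, and the ratio of \<open>b\<close> to the adjugate of \<open>Q\<close> at \<open>w\<close>; what they leave open
  is read off from the congruence equations (\<open>same_class_if_iso\<close>).\<close>

section \<open>Coordinates and circle-forms on the model Lie algebra\<close>

lemma exhaust_5: "(x::5) = 1 \<or> x = 2 \<or> x = 3 \<or> x = 4 \<or> x = 5"
proof (induct x)
  case (of_int z)
  then have "0 \<le> z" and "z < 5" by simp_all
  then have "z = 0 | z = 1 | z = 2 | z = 3 | z = 4" by arith
  then show ?case by auto
qed

lemma UNIV_5: "(UNIV::5 set) = {1,2,3,4,5}"
  using exhaust_5 by auto

lemma forall_5: "(\<forall>i::5. P i) \<longleftrightarrow> P 1 \<and> P 2 \<and> P 3 \<and> P 4 \<and> P 5"
  by (metis exhaust_5)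

lemma sum_5: "sum f (UNIV::5 set) = f 1 + f 2 + f 3 + f 4 + f 5"
  unfolding UNIV_5 by (simp add: ac_simps)

text \<open>A symmetric bilinear form on the span of \<open>e 2\<close>, \<open>e 3\<close>, \<open>e 4\<close> (the model Lie algebra modulo its
  derived algebra), given by its entries and split into three blocks that the automorphisms treat
  separately: the value at \<open>(e 2, e 2)\<close>, the covector that pairs \<open>e 2\<close> with \<open>e 3\<close> and \<open>e 4\<close>, and
  the quadratic part on the span of \<open>e 3\<close> and \<open>e 4\<close>.\<close>

datatype cform = CForm (sq2: complex) (lin3: complex) (lin4: complex)
  (sq3: complex) (mix34: complex) (sq4: complex)

definition cform_val :: "cform \<Rightarrow> complex ^ 5 \<Rightarrow> complex ^ 5 \<Rightarrow> complex" where
  "cform_val F x y = sq2 F * (x$2 * y$2)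
     + lin3 F * (x$2 * y$3 + x$3 * y$2) + lin4 F * (x$2 * y$4 + x$4 * y$2)
     + sq3 F * (x$3 * y$3) + mix34 F * (x$3 * y$4 + x$4 * y$3) + sq4 F * (x$4 * y$4)"

definition cform_mul :: "cform \<Rightarrow> complex ^ 5 \<Rightarrow> complex ^ 5 \<Rightarrow> complex ^ 5" where
  "cform_mul F x y = lie_G x y + cform_val F x y *s e 5"

fun label_cform :: "label \<Rightarrow> cform" where
  "label_cform (L71 \<alpha>) = CForm 1 0 0 0 \<alpha> 0"
| "label_cform (L72 \<alpha>) = CForm 0 0 1 0 \<alpha> 0"
| "label_cform (L73 \<alpha>) = CForm 1 0 1 0 \<alpha> 0"
| "label_cform (L74 \<alpha> \<beta>) = CForm \<beta> 1 1 0 \<alpha> 0"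
| "label_cform L75 = CForm 1 0 0 0 0 1"
| "label_cform (L76 \<alpha>) = CForm \<alpha> 1 0 0 0 1"
| "label_cform (L77 \<alpha>) = CForm \<alpha> 0 1 0 0 1"

lemma e_nth: "e i $ j = (if i = j then 1 else 0)"
  by (auto simp: axis_def)

lemma lie_G_nth:
  "lie_G x y $ 1 = x$1 * y$2 - x$2 * y$1" "lie_G x y $ 2 = 0" "lie_G x y $ 3 = 0"
  "lie_G x y $ 4 = 0" "lie_G x y $ 5 = x$3 * y$4 - x$4 * y$3"
  by (simp_all add: lie_G_def bilinear_ext_def antisym_ext_def lie_table_def sum_5 axis_def)

lemma lie_G_basis:
  "lie_G (e 1) (e 2) = e 1" "lie_G (e 1) (e 3) = 0" "lie_G (e 1) (e 4) = 0"
  "lie_G (e 2) (e 3) = 0" "lie_G (e 2) (e 4) = 0" "lie_G (e 3) (e 4) = e 5"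
  by (simp_all add: vec_eq_iff forall_5 lie_G_nth e_nth)

lemma cform_mul_nth:
  "cform_mul F x y $ 1 = x$1 * y$2 - x$2 * y$1" "cform_mul F x y $ 2 = 0" "cform_mul F x y $ 3 = 0"
  "cform_mul F x y $ 4 = 0" "cform_mul F x y $ 5 = x$3 * y$4 - x$4 * y$3 + cform_val F x y"
  by (simp_all add: cform_mul_def lie_G_nth axis_def)

lemma listed_mul_eq: "listed_mul p = cform_mul (label_cform p)"
proof (intro ext)
  fix x y
  have "listed_mul p x y = lie_G x y + bilinear_ext (sym_ext (circ_table p)) x y"
    by (simp add: listed_mul_def lie_G_def bilinear_ext_def vector_add_ldistrib sum.distrib)
  also have "bilinear_ext (sym_ext (circ_table p)) x y = cform_val (label_cform p) x y *s e 5"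
    by (cases p) (simp_all add: bilinear_ext_def sym_ext_def sum_5 cform_val_def
        vec_eq_iff forall_5 axis_def algebra_simps)
  finally show "listed_mul p x y = cform_mul (label_cform p) x y"
    by (simp add: cform_mul_def)
qed

section \<open>Isomorphism of models as congruence of forms\<close>

text \<open>With \<open>A\<close> the matrix with rows \<open>(a, b)\<close>, \<open>(c, d)\<close>, \<open>F\<close> and \<open>G\<close> regarded as symmetric matrices
  and \<open>M = diag(1, A)\<close>, this says \<open>det A \<cdot> F = M\<^sup>T G M\<close> for invertible \<open>A\<close>: the congruence of
  forms along the map that fixes \<open>e 2\<close> and acts by \<open>A\<close> on the span of \<open>e 3\<close>, \<open>e 4\<close>. The factor
  \<open>det A\<close> is the effect of such a map on \<open>e 5 = [e 3, e 4]\<close>, where the form takes its values.\<close>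

definition cong_cform :: "complex \<Rightarrow> complex \<Rightarrow> complex \<Rightarrow> complex \<Rightarrow> cform \<Rightarrow> cform \<Rightarrow> bool" where
  "cong_cform a b c d F G \<longleftrightarrow> (let D = a * d - b * c in D \<noteq> 0
     \<and> D * sq2 F = sq2 G
     \<and> D * lin3 F = lin3 G * a + lin4 G * c
     \<and> D * lin4 F = lin3 G * b + lin4 G * d
     \<and> D * sq3 F = sq3 G * a^2 + 2 * mix34 G * a * c + sq4 G * c^2
     \<and> D * mix34 F = sq3 G * a * b + mix34 G * (a * d + b * c) + sq4 G * c * d
     \<and> D * sq4 F = sq3 G * b^2 + 2 * mix34 G * b * d + sq4 G * d^2)"

lemma isomorphic_algebras_trans:
  assumes "isomorphic_algebras s1 m1 s2 m2" "isomorphic_algebras s2 m2 s3 m3"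
  shows "isomorphic_algebras s1 m1 s3 m3"
proof -
  obtain f where f: "Vector_Spaces.linear s1 s2 f" "bij f" "\<And>x y. f (m1 x y) = m2 (f x) (f y)"
    using assms(1) unfolding isomorphic_algebras_def by blast
  obtain g where g: "Vector_Spaces.linear s2 s3 g" "bij g" "\<And>x y. g (m2 x y) = m3 (g x) (g y)"
    using assms(2) unfolding isomorphic_algebras_def by blast
  have "Vector_Spaces.linear s1 s3 (g \<circ> f)" using f(1) g(1) by (rule Vector_Spaces.linear_compose)
  moreover have "bij (g \<circ> f)" using f(2) g(2) by (rule bij_comp)
  ultimately show ?thesis unfolding isomorphic_algebras_def
    using f(3) g(3) by (metis comp_apply)
qed

abbreviation cform_iso :: "cform \<Rightarrow> cform \<Rightarrow> bool" (infix "\<simeq>" 50) where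
  "F \<simeq> G \<equiv> isomorphic_algebras (*s) (cform_mul F) (*s) (cform_mul G)"

text \<open>Fixing \<open>e 1\<close> and \<open>e 2\<close>, applying \<open>A\<close> to the span of \<open>e 3\<close>, \<open>e 4\<close> and multiplying \<open>e 5\<close> by
  \<open>det A\<close> is an automorphism of the Lie algebra; the congruence makes it respect the
  circle-products as well.\<close>

lemma cform_iso_if_cong:
  assumes "cong_cform a b c d F G"
  shows "F \<simeq> G"
proof -
  define D where "D = a * d - b * c"
  have D: "D \<noteq> 0" using assms by (simp add: cong_cform_def D_def Let_def)
  note eqs = assms[unfolded cong_cform_def Let_def, folded D_def]
  define f :: "complex^5 \<Rightarrow> complex^5" where
    "f x = (\<chi> i. if i = 1 then x$1 else if i = 2 then x$2 else if i = 3 then a * x$3 + b * x$4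
       else if i = 4 then c * x$3 + d * x$4 else D * x$5)" for x
  define g :: "complex^5 \<Rightarrow> complex^5" where
    "g x = (\<chi> i. if i = 1 then x$1 else if i = 2 then x$2 else if i = 3 then (d * x$3 - b * x$4) / D
       else if i = 4 then (a * x$4 - c * x$3) / D else x$5 / D)" for x
  have f_nth: "f x $ 1 = x$1" "f x $ 2 = x$2" "f x $ 3 = a * x$3 + b * x$4"
    "f x $ 4 = c * x$3 + d * x$4" "f x $ 5 = D * x$5" for x by (simp_all add: f_def)
  have g_nth: "g x $ 1 = x$1" "g x $ 2 = x$2" "g x $ 3 = (d * x$3 - b * x$4) / D"
    "g x $ 4 = (a * x$4 - c * x$3) / D" "g x $ 5 = x$5 / D" for x by (simp_all add: g_def)
  have lin: "Vector_Spaces.linear (*s) (*s) f"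
    by (simp add: Vector_Spaces.linear_iff vec.vector_space_axioms vec_eq_iff forall_5 f_nth algebra_simps)
  have "g (f x) = x" for x
    using D by (simp add: vec_eq_iff forall_5 f_nth g_nth field_simps) (simp add: D_def algebra_simps)
  moreover have "f (g x) = x" for x
    using D by (simp add: vec_eq_iff forall_5 f_nth g_nth field_simps) (simp add: D_def algebra_simps)
  ultimately have bij: "bij f" by (metis bij_def inj_on_inverseI surjI)
  have val: "D * cform_val F x y = cform_val G (f x) (f y)" for x y
  proof -
    have "D * cform_val F x y = (D * sq2 F) * (x$2 * y$2)
     + (D * lin3 F) * (x$2 * y$3 + x$3 * y$2) + (D * lin4 F) * (x$2 * y$4 + x$4 * y$2)
     + (D * sq3 F) * (x$3 * y$3) + (D * mix34 F) * (x$3 * y$4 + x$4 * y$3)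
     + (D * sq4 F) * (x$4 * y$4)"
      by (simp add: cform_val_def algebra_simps)
    also have "\<dots> = cform_val G (f x) (f y)"
      using eqs by (simp add: cform_val_def f_nth algebra_simps power2_eq_square)
    finally show ?thesis .
  qed
  have "f (cform_mul F x y) = cform_mul G (f x) (f y)" for x y
    using val[of x y]
    by (simp add: vec_eq_iff forall_5 f_nth cform_mul_nth distrib_left) (simp add: D_def algebra_simps)
  with lin bij show ?thesis unfolding isomorphic_algebras_def by blast
qed

text \<open>An isomorphism preserves the commutator, hence is an automorphism of the Lie algebra, and the
  six brackets of basis vectors force its shape. The image of \<open>e 1 = [e 1, e 2]\<close> is a multiple of
  \<open>e 1\<close>; then \<open>e 2\<close> has \<open>e 2\<close>-coefficient 1, while \<open>e 3\<close> and \<open>e 4\<close> stay in the nilradical; and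
  since \<open>e 2\<close> commutes with \<open>e 3\<close> and \<open>e 4\<close>, its image has no component along these two. So
  modulo the derived algebra every automorphism is one of those used in the converse direction.\<close>

lemma cong_if_cform_iso:
  assumes "F \<simeq> G"
  obtains a b c d where "cong_cform a b c d F G"
proof -
  obtain f where lin: "Vector_Spaces.linear (*s) (*s) f" and bij: "bij f"
    and mult: "\<And>x y. f (cform_mul F x y) = cform_mul G (f x) (f y)"
    using assms unfolding isomorphic_algebras_def by blast
  interpret f: Vector_Spaces.linear "(*s)" "(*s)" f by (rule lin)
  define D where "D = f (e 3) $ 3 * f (e 4) $ 4 - f (e 4) $ 3 * f (e 3) $ 4"
  have brk: "f (lie_G x y) = lie_G (f x) (f y)" for x y
  proof -
    have two: "lie_G x y = (1/2) *s (cform_mul H x y - cform_mul H y x)" for H x y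
      by (simp add: vec_eq_iff forall_5 cform_mul_nth lie_G_nth cform_val_def algebra_simps)
    show ?thesis unfolding two[of x y F] two[of "f x" "f y" G] by (simp add: f.scale f.diff mult)
  qed
  have circ: "cform_val F x y *s f (e 5) = cform_val G (f x) (f y) *s e 5" for x y
  proof -
    have two: "cform_val H x y *s e 5 = cform_mul H x y - lie_G x y" for H x y
      by (simp add: cform_mul_def)
    show ?thesis unfolding two f.scale[symmetric] by (simp add: f.diff mult brk)
  qed
  note brk_basis = lie_G_basis[THEN arg_cong[where f = f], unfolded brk f.zero, symmetric]
  note comps = brk_basis[unfolded vec_eq_iff forall_5 lie_G_nth zero_index]
  have nz: "f (e i) \<noteq> 0" for i
    using bij f.zero by (metis axis_eq_0_iff bij_is_inj injD zero_neq_one)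
  have e1: "f (e 1) $ 2 = 0" "f (e 1) $ 3 = 0" "f (e 1) $ 4 = 0" "f (e 1) $ 5 = 0"
    using comps(1) by simp_all
  then have m11: "f (e 1) $ 1 \<noteq> 0" using nz[of 1] by (simp add: vec_eq_iff forall_5)
  have m22: "f (e 2) $ 2 = 1" using comps(1) e1 m11 by simp
  have m23: "f (e 3) $ 2 = 0" using comps(2) e1 m11 by simp
  have m24: "f (e 4) $ 2 = 0" using comps(3) e1 m11 by simp
  have fe5: "f (e 5) = D *s e 5"
    using comps(6) m23 m24 by (simp add: vec_eq_iff forall_5 axis_def D_def)
  have D: "D \<noteq> 0" using fe5 nz[of 5] by auto
  have "f (e 2) $ 3 * f (e 3) $ 4 = f (e 2) $ 4 * f (e 3) $ 3"
    "f (e 2) $ 3 * f (e 4) $ 4 = f (e 2) $ 4 * f (e 4) $ 3"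
    using comps(4,5) by simp_all
  \<comment> \<open>The vector \<open>(f (e 2) $ 3, f (e 2) $ 4)\<close> is proportional to two independent vectors.\<close>
  then have "f (e 2) $ 3 * D = 0" "f (e 2) $ 4 * D = 0" unfolding D_def by algebra+
  then have m32: "f (e 2) $ 3 = 0" "f (e 2) $ 4 = 0" using D by simp_all
  have val: "D * cform_val F x y = cform_val G (f x) (f y)" for x y
    using circ[of x y, unfolded fe5] by (simp add: vec_eq_iff forall_5 axis_def mult.commute)
  have "cong_cform (f (e 3) $ 3) (f (e 4) $ 3) (f (e 3) $ 4) (f (e 4) $ 4) F G"
    using D val[of "e 2" "e 2"] val[of "e 2" "e 3"] val[of "e 2" "e 4"]
      val[of "e 3" "e 3"] val[of "e 3" "e 4"] val[of "e 4" "e 4"]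
    unfolding cong_cform_def Let_def D_def[symmetric]
    by (simp add: cform_val_def e_nth m22 m23 m24 m32 algebra_simps power2_eq_square)
  then show thesis by (rule that)
qed

section \<open>From symmetric Leibniz algebras to forms\<close>

context symmetric_leibniz_algebra
begin

definition circ :: "'a \<Rightarrow> 'a \<Rightarrow> 'a" where
  "circ x y = scale (1/2) (mul x y + mul y x)"

lemma mul_add_left: "mul (x + y) z = mul x z + mul y z"
  using linear_left by (simp add: Vector_Spaces.linear_iff)

lemma mul_add_right: "mul z (x + y) = mul z x + mul z y"
  using linear_right by (simp add: Vector_Spaces.linear_iff)

lemma mul_scale_left: "mul (scale k x) z = scale k (mul x z)"
  using linear_left by (simp add: Vector_Spaces.linear_iff)

lemma mul_scale_right: "mul z (scale k x) = scale k (mul z x)"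
  using linear_right by (simp add: Vector_Spaces.linear_iff)

lemma mul_diff_left: "mul (x - y) z = mul x z - mul y z"
  using mul_add_left[of "x - y" y z] by (simp add: algebra_simps)

lemma mul_diff_right: "mul z (x - y) = mul z x - mul z y"
  using mul_add_right[of z "x - y" y] by (simp add: algebra_simps)

lemma mul_eq_bracket_plus_circ: "mul x y = bracket x y + circ x y"
proof -
  have "bracket x y + circ x y = scale (1/2) (mul x y + mul x y)"
    unfolding bracket_def circ_def by (simp add: scale_right_distrib[symmetric])
  also have "\<dots> = mul x y"
    by (simp add: scale_right_distrib scale_left_distrib[symmetric])
  finally show ?thesis ..
qed

lemma circ_commute: "circ x y = circ y x"
  by (simp add: circ_def add.commute)

text \<open>Add the two Leibniz identities for the same triple: the products \<open>x \<cdot> (y \<cdot> z)\<close> and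
  \<open>(x \<cdot> y) \<cdot> z\<close> cancel.\<close>

lemma mul_anticommutes_with_products: "mul y (mul x z) = - mul (mul x z) y"
proof -
  have "mul x (mul y z) = mul x (mul y z) + mul (mul x z) y + mul y (mul x z)"
    using left_leibniz[of x y z] right_leibniz[of x y z] by simp
  then show ?thesis by (simp add: add.assoc add_eq_0_iff)
qed

text \<open>By the left Leibniz identity \<open>(x \<cdot> y) \<cdot> z\<close> is the commutator of the left multiplications by \<open>x\<close>
  and \<open>y\<close> applied to \<open>z\<close>, so it changes sign when \<open>x\<close> and \<open>y\<close> are exchanged.\<close>

lemma symmetrized_mul_zero: "mul (mul x y + mul y x) z = 0"
  using left_leibniz[of x y z] left_leibniz[of y x z] by (simp add: mul_add_left)

text \<open>Every product anticommutes with all elements, hence so does every bracket.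
  Together with the next lemma: the circle-product factors through the quotient by the derived
  algebra of the underlying Lie algebra and takes its values in the centre of that algebra.\<close>

lemma circ_bracket: "circ (bracket x y) z = 0"
  by (simp add: circ_def bracket_def mul_scale_left mul_scale_right mul_diff_left mul_diff_right
      mul_anticommutes_with_products scale_right_diff_distrib)

lemma bracket_circ: "bracket (circ x y) z = 0"
proof -
  have "mul z (mul x y + mul y x) = - mul (mul x y + mul y x) z"
    by (simp add: mul_add_right mul_add_left mul_anticommutes_with_products)
  then show ?thesis
    by (simp add: bracket_def circ_def mul_scale_left mul_scale_right symmetrized_mul_zero)
qed

end

text \<open>For the model Lie algebra the derived algebra is spanned by \<open>e 1\<close>, \<open>e 5\<close> and the centre by \<open>e 5\<close>.
  A circle-product that kills the former and lands in the latter is a symmetric form on the span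
  of \<open>e 2\<close>, \<open>e 3\<close>, \<open>e 4\<close> times \<open>e 5\<close>.\<close>

lemma G_isomorphic_cform_mul:
  fixes scale :: "complex \<Rightarrow> 'a::ab_group_add \<Rightarrow> 'a" and mul :: "'a \<Rightarrow> 'a \<Rightarrow> 'a"
  assumes "symmetric_leibniz_algebra scale mul"
    and "isomorphic_algebras scale (complex_algebra.bracket scale mul) (*s) lie_G"
  obtains F where "isomorphic_algebras scale mul (*s) (cform_mul F)"
proof -
  interpret symmetric_leibniz_algebra scale mul by (rule assms(1))
  obtain g where lin: "Vector_Spaces.linear scale (*s) g" and bij: "bij g"
    and brk: "\<And>x y. g (bracket x y) = lie_G (g x) (g y)"
    using assms(2) unfolding isomorphic_algebras_def by blast
  interpret g: Vector_Spaces.linear scale "(*s)" g by (rule lin)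
  define h where "h = inv g"
  have gh: "g (h u) = u" for u using bij by (simp add: h_def bij_is_surj surj_f_inv_f)
  have hg: "h (g x) = x" for x using bij by (simp add: h_def bij_is_inj)
  have h_add: "h (u + v) = h u + h v" for u v by (metis gh hg g.add)
  have h_scale: "h (k *s u) = scale k (h u)" for k u by (metis gh hg g.scale)
  have h_brk: "h (lie_G u v) = bracket (h u) (h v)" for u v by (metis gh hg brk)
  define C where "C u v = g (circ (h u) (h v))" for u v
  have C_commute: "C u v = C v u" for u v by (simp add: C_def circ_commute)
  have C_add: "C (u + u') v = C u v + C u' v" for u u' v
    by (simp add: C_def h_add circ_def mul_add_left mul_add_right scale_right_distrib g.add algebra_simps)
  have C_scale: "C (k *s u) v = k *s C u v" for k u v
    by (simp add: C_def h_scale circ_def mul_scale_left mul_scale_right scale_right_distrib[symmetric]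
        scale_left_commute g.scale[symmetric])
  have "C (lie_G u v) w = 0" for u v w
    by (simp add: C_def h_brk circ_bracket g.zero)
  from this[of "e 1" "e 2"] this[of "e 3" "e 4"]
  have C_derived: "C (e 1) w = 0" "C (e 5) w = 0" for w
    by (simp_all add: lie_G_basis)
  have "lie_G (C u v) w = 0" for u v w
    using brk[of "circ (h u) (h v)" "h w"] by (simp add: C_def gh bracket_circ g.zero)
  from this[of _ _ "e 1"] this[of _ _ "e 2"] this[of _ _ "e 3"] this[of _ _ "e 4"]
  have C_central: "C u v = C u v $ 5 *s e 5" for u v
    by (simp add: vec_eq_iff forall_5 lie_G_nth e_nth)
  have expand: "u = u$1 *s e 1 + u$2 *s e 2 + u$3 *s e 3 + u$4 *s e 4 + u$5 *s e 5" for u :: "complex^5"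
    by (simp add: vec_eq_iff forall_5 e_nth)
  have left: "C u v = u$2 *s C (e 2) v + u$3 *s C (e 3) v + u$4 *s C (e 4) v" for u v
    by (subst expand[of u]) (simp add: C_add C_scale C_derived)
  define F where "F = CForm (C (e 2) (e 2) $ 5) (C (e 2) (e 3) $ 5) (C (e 2) (e 4) $ 5)
    (C (e 3) (e 3) $ 5) (C (e 3) (e 4) $ 5) (C (e 4) (e 4) $ 5)"
  have "C u v $ 5 = cform_val F u v" for u v
  proof -
    have "C u v $ 5 = u$2 * C v (e 2) $ 5 + u$3 * C v (e 3) $ 5 + u$4 * C v (e 4) $ 5"
      by (simp add: left[of u v] C_commute)
    then show ?thesis
      by (simp add: left[of v] cform_val_def F_def C_commute[of "e 3" "e 2"] C_commute[of "e 4" "e 2"]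
          C_commute[of "e 4" "e 3"] algebra_simps)
  qed
  then have "g (mul x y) = cform_mul F (g x) (g y)" for x y
    using C_central[of "g x" "g y"]
    by (simp add: mul_eq_bracket_plus_circ g.add brk cform_mul_def) (simp add: C_def hg)
  with lin bij have "isomorphic_algebras scale mul (*s) (cform_mul F)"
    unfolding isomorphic_algebras_def by blast
  then show thesis by (rule that)
qed

text \<open>If \<open>e 2\<close> is orthogonal to everything for the form, then the decomposition of the Lie algebra
  into the span of \<open>e 1\<close>, \<open>e 2\<close> and the span of \<open>e 3\<close>, \<open>e 4\<close>, \<open>e 5\<close> is one of the whole algebra.\<close>

lemma split_if_e2_circ_zero:
  fixes scale :: "complex \<Rightarrow> 'a::ab_group_add \<Rightarrow> 'a" and mul :: "'a \<Rightarrow> 'a \<Rightarrow> 'a"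
  assumes "complex_algebra scale mul"
    and "isomorphic_algebras scale mul (*s) (cform_mul F)"
    and "sq2 F = 0" "lin3 F = 0" "lin4 F = 0"
  shows "complex_algebra.split scale mul"
proof -
  interpret complex_algebra scale mul by (rule assms(1))
  obtain g where lin: "Vector_Spaces.linear scale (*s) g" and bij: "bij g"
    and mult: "\<And>x y. g (mul x y) = cform_mul F (g x) (g y)"
    using assms(2) unfolding isomorphic_algebras_def by blast
  interpret g: Vector_Spaces.linear scale "(*s)" g by (rule lin)
  have inv: "g (inv g u) = u" for u using bij by (simp add: bij_is_surj surj_f_inv_f)
  have zero: "x = 0" if "g x = 0" for x using bij that g.zero by (metis bij_is_inj injD)
  define I where "I = {x. g x $ 3 = 0 \<and> g x $ 4 = 0 \<and> g x $ 5 = 0}"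
  define J where "J = {x. g x $ 1 = 0 \<and> g x $ 2 = 0}"
  have "two_sided_ideal I"
    unfolding two_sided_ideal_def subspace_def
    by (auto simp: I_def g.add g.scale g.zero mult cform_mul_nth cform_val_def assms(3-5))
  moreover have "two_sided_ideal J"
    unfolding two_sided_ideal_def subspace_def
    by (auto simp: J_def g.add g.scale g.zero mult cform_mul_nth)
  moreover have "inv g (e 1) \<in> I" "inv g (e 1) \<noteq> 0"
    using inv[of "e 1"] g.zero by (auto simp: I_def e_nth)
  then have "I \<noteq> {0}" by blast
  moreover have "inv g (e 3) \<in> J" "inv g (e 3) \<noteq> 0"
    using inv[of "e 3"] g.zero by (auto simp: J_def e_nth)
  then have "J \<noteq> {0}" by blast
  moreover have "I \<inter> J = {0}"
    by (auto simp: I_def J_def g.zero vec_eq_iff forall_5 intro!: zero)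
  moreover have "\<exists>i\<in>I. \<exists>j\<in>J. x = i + j" for x
  proof (intro bexI)
    let ?i = "inv g (g x $ 1 *s e 1 + g x $ 2 *s e 2)"
    show "x = ?i + (x - ?i)" by simp
    show "?i \<in> I" by (simp add: I_def inv e_nth)
    show "x - ?i \<in> J" by (simp add: J_def g.diff inv e_nth)
  qed
  ultimately show ?thesis unfolding split_def by blast
qed

lemma cform_iso_trans: "F \<simeq> G \<Longrightarrow> G \<simeq> H \<Longrightarrow> F \<simeq> H"
  by (rule isomorphic_algebras_trans)

section \<open>Normal forms\<close>

lemma cong_linear_part_nonzero:
  assumes "cong_cform a b c d F G" "sq2 F \<noteq> 0 \<or> lin3 F \<noteq> 0 \<or> lin4 F \<noteq> 0"
  shows "sq2 G \<noteq> 0 \<or> lin3 G \<noteq> 0 \<or> lin4 G \<noteq> 0"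
  using assms by (auto simp: cong_cform_def Let_def)

text \<open>The binary quadratic form \<open>q X\<^sup>2 + 2 r X Y + t Y\<^sup>2\<close> with \<open>q \<noteq> 0\<close> factors over the complex numbers
  as \<open>(q X + (r + s) Y) (q X + (r - s) Y) / q\<close> with \<open>s\<^sup>2 = r\<^sup>2 - q t\<close>. If \<open>s \<noteq> 0\<close>, the two factors
  serve as new coordinates; if \<open>s = 0\<close>, their common value is the second new coordinate, and
  \<open>- Y\<close> as the first one makes the determinant equal to \<open>q\<close>, which cancels the denominator.\<close>

lemma normalize_quadratic_pivot:
  assumes q: "sq3 F \<noteq> 0"
  obtains a b c d G where "cong_cform a b c d F G" "sq3 G = 0"
    "sq4 G = 0 \<or> mix34 G = 0 \<and> sq4 G = 1"
proof -
  define q r t where "q = sq3 F" and "r = mix34 F" and "t = sq4 F"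
  define s where "s = csqrt (r^2 - q * t)"
  have s2: "s^2 = r^2 - q * t" by (simp add: s_def)
  have q0: "q \<noteq> 0" using q by (simp add: q_def)
  \<comment> \<open>The transformed covector always exists: it is the old one times the adjugate matrix.\<close>
  have lin: "\<exists>l3 l4. D * lin3 F = l3 * a + l4 * c \<and> D * lin4 F = l3 * b + l4 * d"
    if "D = a * d - b * c" for a b c d D
    by (rule exI[of _ "d * lin3 F - c * lin4 F"], rule exI[of _ "a * lin4 F - b * lin3 F"])
      (simp add: that algebra_simps)
  show thesis
  proof (cases "s = 0")
    case False
    obtain l3 l4 where l: "(q * (r - s) - (r + s) * q) * lin3 F = l3 * q + l4 * q"
      "(q * (r - s) - (r + s) * q) * lin4 F = l3 * (r + s) + l4 * (r - s)"
      using lin[OF refl] by blast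
    have D: "q * (r - s) - (r + s) * q = - 2 * q * s" by algebra
    have "cong_cform q (r + s) q (r - s) F (CForm (- 2 * q * s * sq2 F) l3 l4 0 (- s) 0)"
      unfolding cong_cform_def Let_def D q_def[symmetric] r_def[symmetric] t_def[symmetric] cform.sel
    proof (intro conjI)
      show "- 2 * q * s \<noteq> 0" using False q0 by simp
      show "- 2 * q * s * t = 0 * (r + s)^2 + 2 * - s * (r + s) * (r - s) + 0 * (r - s)^2"
        using s2 by algebra
    qed (rule refl l[unfolded D] | algebra)+
    then show ?thesis by (rule that) simp_all
  next
    case True
    obtain l3 l4 where l: "(0 * r - (-1) * q) * lin3 F = l3 * 0 + l4 * q"
      "(0 * r - (-1) * q) * lin4 F = l3 * (-1) + l4 * r"
      using lin[OF refl] by blast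
    have "cong_cform 0 (-1) q r F (CForm (q * sq2 F) l3 l4 0 0 1)"
      using l q0 s2 True
      unfolding cong_cform_def Let_def q_def[symmetric] r_def[symmetric] t_def[symmetric] cform.sel
      by (simp add: power2_eq_square)
    then show ?thesis by (rule that) simp_all
  qed
qed

text \<open>If the coefficient of \<open>X\<^sup>2\<close> vanishes, exchanging \<open>e 3\<close> and \<open>e 4\<close> up to sign supplies the
  pivot unless that of \<open>Y\<^sup>2\<close> vanishes as well and the form is already normal. The last
  conclusion carries along the condition that excludes split algebras.\<close>

lemma iso_normal_quadratic:
  obtains G where "F \<simeq> G" "sq3 G = 0" "sq4 G = 0 \<or> mix34 G = 0 \<and> sq4 G = 1"
    "sq2 F \<noteq> 0 \<or> lin3 F \<noteq> 0 \<or> lin4 F \<noteq> 0 \<Longrightarrow> sq2 G \<noteq> 0 \<or> lin3 G \<noteq> 0 \<or> lin4 G \<noteq> 0"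
proof -
  define S where "S = CForm (sq2 F) (lin4 F) (- lin3 F) (sq4 F) (- mix34 F) (sq3 F)"
  have S: "cong_cform 0 1 (-1) 0 F S"
    by (simp add: cong_cform_def S_def)
  consider "sq3 F \<noteq> 0" | "sq3 F = 0" "sq4 F \<noteq> 0" | "sq3 F = 0" "sq4 F = 0" by blast
  then show thesis
  proof cases
    case 1
    then obtain a b c d G where G: "cong_cform a b c d F G" "sq3 G = 0"
      "sq4 G = 0 \<or> mix34 G = 0 \<and> sq4 G = 1"
      by (rule normalize_quadratic_pivot)
    show thesis
      using that[OF cform_iso_if_cong[OF G(1)] G(2,3) cong_linear_part_nonzero[OF G(1)]] .
  next
    case 2
    then have "sq3 S \<noteq> 0" by (simp add: S_def)
    then obtain a b c d G where G: "cong_cform a b c d S G" "sq3 G = 0"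
      "sq4 G = 0 \<or> mix34 G = 0 \<and> sq4 G = 1"
      by (rule normalize_quadratic_pivot)
    show thesis
      using that[OF cform_iso_trans[OF cform_iso_if_cong[OF S] cform_iso_if_cong[OF G(1)]] G(2,3)]
        cong_linear_part_nonzero[OF G(1)] cong_linear_part_nonzero[OF S] by blast
  next
    case 3
    have "cong_cform 1 0 0 1 F F" by (simp add: cong_cform_def)
    from that[OF cform_iso_if_cong[OF this]] 3 show thesis by simp
  qed
qed

lemma iso_labelI:
  "cong_cform a b c d F (label_cform p) \<Longrightarrow> p \<in> labels \<Longrightarrow> \<exists>p\<in>labels. F \<simeq> label_cform p"
  using cform_iso_if_cong by blast

lemma iso_label_hyperbolic_lin3_zero:
  assumes "b \<noteq> 0 \<or> w \<noteq> 0"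
  shows "\<exists>p\<in>labels. CForm b 0 w 0 \<alpha> 0 \<simeq> label_cform p"
proof -
  consider "w = 0" "b \<noteq> 0" | "w \<noteq> 0" "b = 0" | "w \<noteq> 0" "b \<noteq> 0" using assms by blast
  then show ?thesis
  proof cases
    case 1
    then have "cong_cform (1/b) 0 0 1 (CForm b 0 w 0 \<alpha> 0) (label_cform (L71 \<alpha>))"
      by (simp add: cong_cform_def)
    then show ?thesis by (rule iso_labelI) (simp add: labels_def)
  next
    case 2
    then have "cong_cform (1/w) 0 0 1 (CForm b 0 w 0 \<alpha> 0) (label_cform (L72 \<alpha>))"
      by (simp add: cong_cform_def)
    then show ?thesis by (rule iso_labelI) (simp add: labels_def)
  next
    case 3
    then have "cong_cform (1/w) 0 0 (w/b) (CForm b 0 w 0 \<alpha> 0) (label_cform (L73 \<alpha>))"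
      by (simp add: cong_cform_def)
    then show ?thesis by (rule iso_labelI) (simp add: labels_def)
  qed
qed

text \<open>Here the quadratic part is \<open>2 \<alpha> X Y\<close>. For \<open>\<alpha> \<noteq> 0\<close> only the diagonal matrices and, at the cost
  of a sign in \<open>\<alpha>\<close>, the exchange of the two isotropic lines are left. They scale the two entries
  of the covector independently or swap them, but cannot clear a nonzero entry; two nonzero
  entries give the family \<open>L74\<close>. For \<open>\<alpha> = 0\<close> all matrices are available and a
  nonzero covector can be made \<open>(0, 1)\<close>.\<close>

lemma iso_label_hyperbolic:
  assumes "b \<noteq> 0 \<or> v \<noteq> 0 \<or> w \<noteq> 0"
  shows "\<exists>p\<in>labels. CForm b v w 0 \<alpha> 0 \<simeq> label_cform p"
proof -
  consider "v = 0" | "v \<noteq> 0" "w = 0" | "v \<noteq> 0" "w \<noteq> 0" "\<alpha> \<noteq> 0" | "v \<noteq> 0" "w \<noteq> 0" "\<alpha> = 0" by blast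
  then show ?thesis
  proof cases
    case 1
    then show ?thesis using assms iso_label_hyperbolic_lin3_zero by blast
  next
    case 2
    then have "cong_cform 0 1 (-1) 0 (CForm b v w 0 \<alpha> 0) (CForm b 0 (-v) 0 (-\<alpha>) 0)"
      by (simp add: cong_cform_def)
    then show ?thesis
      using 2 iso_label_hyperbolic_lin3_zero[of b "-v" "-\<alpha>"] cform_iso_if_cong cform_iso_trans
      by (metis neg_equal_0_iff_equal)
  next
    case 3
    then have "cong_cform (1/w) 0 0 (1/v) (CForm b v w 0 \<alpha> 0) (label_cform (L74 \<alpha> (b / (v * w))))"
      by (simp add: cong_cform_def field_simps)
    then show ?thesis by (rule iso_labelI) (use 3 in \<open>simp add: labels_def\<close>)
  next
    case 4
    then have "cong_cform 0 (-1/v) v w (CForm b v w 0 \<alpha> 0) (CForm b 0 1 0 0 0)"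
      by (simp add: cong_cform_def)
    then show ?thesis
      using iso_label_hyperbolic_lin3_zero[of b 1 0] cform_iso_if_cong cform_iso_trans
      by (metis zero_neq_one)
  qed
qed

text \<open>Here the quadratic part is \<open>Y\<^sup>2\<close>, preserved by the upper triangular matrices with equal
  diagonal entries. The diagonal entry scales the first nonzero entry of the covector (or, if the
  covector vanishes, the value at \<open>(e 2, e 2)\<close>) to 1, and the upper right entry clears the rest
  of the covector.\<close>

lemma iso_label_parabolic:
  assumes "b \<noteq> 0 \<or> v \<noteq> 0 \<or> w \<noteq> 0"
  shows "\<exists>p\<in>labels. CForm b v w 0 0 1 \<simeq> label_cform p"
proof -
  consider "v = 0" "w = 0" "b \<noteq> 0" | "v \<noteq> 0" | "v = 0" "w \<noteq> 0" using assms by blast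
  then show ?thesis
  proof cases
    case 1
    then have "cong_cform (1 / csqrt b) 0 0 (1 / csqrt b) (CForm b v w 0 0 1) (label_cform L75)"
      by (simp add: cong_cform_def power_divide flip: power2_eq_square)
    then show ?thesis by (rule iso_labelI) (simp add: labels_def)
  next
    case 2
    then have "cong_cform (1/v) (w/v^2) 0 (1/v) (CForm b v w 0 0 1) (label_cform (L76 (b/v^2)))"
      by (simp add: cong_cform_def power2_eq_square)
    then show ?thesis by (rule iso_labelI) (simp add: labels_def)
  next
    case 3
    then have "cong_cform (1/w) 0 0 (1/w) (CForm b v w 0 0 1) (label_cform (L77 (b/w^2)))"
      by (simp add: cong_cform_def power2_eq_square)
    then show ?thesis by (rule iso_labelI) (simp add: labels_def)
  qed
qed

lemma iso_label:
  assumes "sq2 F \<noteq> 0 \<or> lin3 F \<noteq> 0 \<or> lin4 F \<noteq> 0"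
  shows "\<exists>p\<in>labels. F \<simeq> label_cform p"
proof -
  obtain G where G: "F \<simeq> G" "sq3 G = 0" "sq4 G = 0 \<or> mix34 G = 0 \<and> sq4 G = 1"
    and nz: "sq2 G \<noteq> 0 \<or> lin3 G \<noteq> 0 \<or> lin4 G \<noteq> 0"
    using iso_normal_quadratic[of F] assms by metis
  have "\<exists>p\<in>labels. G \<simeq> label_cform p"
    using G(2,3) iso_label_hyperbolic[OF nz, of "mix34 G"] iso_label_parabolic[OF nz]
    by (cases G) auto
  with G(1) show ?thesis using cform_iso_trans by blast
qed

section \<open>Separating the normal forms\<close>

text \<open>The vanishing of each of the three blocks is invariant, and so is the determinant of the
  quadratic part, which scales by \<open>(det A)\<^sup>2\<close> under congruence and by the same factor through the
  change of \<open>e 5\<close>. The last expression is the adjugate of the quadratic part evaluated at the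
  covector; it scales by \<open>det A\<close>, exactly as the value at \<open>(e 2, e 2)\<close> does, so the ratio of the
  two is an invariant.\<close>

lemma cong_invariants:
  assumes "cong_cform a b c d F G"
  defines "D \<equiv> a * d - b * c"
  shows "D \<noteq> 0"
    and "D * sq2 F = sq2 G"
    and "lin3 F = 0 \<and> lin4 F = 0 \<longleftrightarrow> lin3 G = 0 \<and> lin4 G = 0"
    and "sq3 F = 0 \<and> mix34 F = 0 \<and> sq4 F = 0 \<longleftrightarrow> sq3 G = 0 \<and> mix34 G = 0 \<and> sq4 G = 0"
    and "(mix34 F)^2 - sq3 F * sq4 F = (mix34 G)^2 - sq3 G * sq4 G"
    and "D * (sq4 F * (lin3 F)^2 - 2 * mix34 F * lin3 F * lin4 F + sq3 F * (lin4 F)^2)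
       = sq4 G * (lin3 G)^2 - 2 * mix34 G * lin3 G * lin4 G + sq3 G * (lin4 G)^2"
proof -
  note eqs = assms(1)[unfolded cong_cform_def Let_def, folded D_def]
  show D: "D \<noteq> 0" and "D * sq2 F = sq2 G" using eqs by auto
  have lin: "D * lin3 F = lin3 G * a + lin4 G * c" "D * lin4 F = lin3 G * b + lin4 G * d"
    using eqs by auto
  have quad: "D * sq3 F = sq3 G * a^2 + 2 * mix34 G * a * c + sq4 G * c^2"
    "D * mix34 F = sq3 G * a * b + mix34 G * (a * d + b * c) + sq4 G * c * d"
    "D * sq4 F = sq3 G * b^2 + 2 * mix34 G * b * d + sq4 G * d^2" using eqs by auto
  have linG: "lin3 G = lin3 F * d - lin4 F * c" "lin4 G = lin4 F * a - lin3 F * b"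
  proof -
    have "D * lin3 G = D * (lin3 F * d - lin4 F * c)" "D * lin4 G = D * (lin4 F * a - lin3 F * b)"
      using lin unfolding D_def by algebra+
    then show "lin3 G = lin3 F * d - lin4 F * c" "lin4 G = lin4 F * a - lin3 F * b"
      using D by simp_all
  qed
  then show "lin3 F = 0 \<and> lin4 F = 0 \<longleftrightarrow> lin3 G = 0 \<and> lin4 G = 0"
    using lin D by auto
  have quadG: "D * sq3 G = sq3 F * d^2 - 2 * mix34 F * c * d + sq4 F * c^2"
    "D * mix34 G = - sq3 F * b * d + mix34 F * (a * d + b * c) - sq4 F * a * c"
    "D * sq4 G = sq3 F * b^2 - 2 * mix34 F * a * b + sq4 F * a^2"
  proof -
    have "D * (D * sq3 G) = D * (sq3 F * d^2 - 2 * mix34 F * c * d + sq4 F * c^2)"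
      "D * (D * mix34 G) = D * (- sq3 F * b * d + mix34 F * (a * d + b * c) - sq4 F * a * c)"
      "D * (D * sq4 G) = D * (sq3 F * b^2 - 2 * mix34 F * a * b + sq4 F * a^2)"
      using quad unfolding D_def by algebra+
    then show "D * sq3 G = sq3 F * d^2 - 2 * mix34 F * c * d + sq4 F * c^2"
      "D * mix34 G = - sq3 F * b * d + mix34 F * (a * d + b * c) - sq4 F * a * c"
      "D * sq4 G = sq3 F * b^2 - 2 * mix34 F * a * b + sq4 F * a^2"
      using D by simp_all
  qed
  show "sq3 F = 0 \<and> mix34 F = 0 \<and> sq4 F = 0 \<longleftrightarrow> sq3 G = 0 \<and> mix34 G = 0 \<and> sq4 G = 0"
    using quad quadG D by auto
  have "D^2 * ((mix34 F)^2 - sq3 F * sq4 F) = D^2 * ((mix34 G)^2 - sq3 G * sq4 G)"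
    using quad unfolding D_def by algebra
  then show "(mix34 F)^2 - sq3 F * sq4 F = (mix34 G)^2 - sq3 G * sq4 G" using D by simp
  have "sq4 G * (lin3 G)^2 - 2 * mix34 G * lin3 G * lin4 G + sq3 G * (lin4 G)^2
      = (D * sq4 F) * (lin3 F)^2 - 2 * (D * mix34 F) * lin3 F * lin4 F + (D * sq3 F) * (lin4 F)^2"
    unfolding linG quad by algebra
  then show "D * (sq4 F * (lin3 F)^2 - 2 * mix34 F * lin3 F * lin4 F + sq3 F * (lin4 F)^2)
       = sq4 G * (lin3 G)^2 - 2 * mix34 G * lin3 G * lin4 G + sq3 G * (lin4 G)^2"
    by (simp add: algebra_simps)
qed

definition same_class :: "label \<Rightarrow> label \<Rightarrow> bool" where
  "same_class p q \<longleftrightarrow> p = q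
     \<or> (\<exists>\<alpha> \<beta>. p = L74 \<alpha> \<beta> \<and> q = L74 (- \<alpha>) (- \<beta>)) \<or> (\<exists>\<alpha>. p = L71 \<alpha> \<and> q = L71 (- \<alpha>))"

text \<open>The determinant of the quadratic part fixes \<open>\<alpha>\<close> up to sign in \<open>L71\<close> to \<open>L74\<close>; together with
  the vanishing of the quadratic part it sets these families apart from \<open>L75\<close> to \<open>L77\<close>. The
  vanishing of the covector, of the value at \<open>(e 2, e 2)\<close> and of the adjugate form at the covector
  separates the families within each group, and the ratio of the last two fixes \<open>\<beta>\<close> in \<open>L74\<close> (up
  to the sign of \<open>\<alpha>\<close>) and the parameter of \<open>L76\<close>. For \<open>L72\<close>, \<open>L73\<close> and \<open>L77\<close>, where the
  covector is \<open>(0, 1)\<close>, the congruence equations themselves give \<open>c = 0\<close> and \<open>det A = d\<close>, hence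
  \<open>a = 1\<close>, and the sign of \<open>\<alpha>\<close>, respectively the parameter of \<open>L77\<close>, is determined.\<close>

lemma same_class_if_iso:
  assumes "p \<in> labels" "q \<in> labels" "label_cform p \<simeq> label_cform q"
  shows "same_class p q"
proof -
  obtain a b c d where cong: "cong_cform a b c d (label_cform p) (label_cform q)"
    using cong_if_cform_iso[OF assms(3)] by blast
  note inv = cong_invariants[OF cong]
  note eqs = cong[unfolded cong_cform_def Let_def]
  \<comment> \<open>In \<open>L77\<close>, \<open>d = det A\<close> and the coefficient of \<open>Y\<^sup>2\<close> gives \<open>det A = d\<^sup>2\<close>, so \<open>d = 1\<close>.\<close>
  have sq_id: "x = x^2 \<longleftrightarrow> x = 0 \<or> x = 1" for x :: complex
    by (auto simp: power2_eq_square)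
  show ?thesis
    using inv assms(1,2) eqs
    by (cases p; cases q) 
      (auto simp: same_class_def labels_def power2_eq_iff sq_id)
qed

lemma iso_if_same_class:
  assumes "same_class p q"
  shows "label_cform p \<simeq> label_cform q"
proof -
  have "cong_cform 1 0 0 1 (label_cform p) (label_cform p)" by (simp add: cong_cform_def)
  moreover have "cong_cform 0 (-1) (-1) 0 (label_cform (L74 \<alpha> \<beta>)) (label_cform (L74 (-\<alpha>) (-\<beta>)))" for \<alpha> \<beta>
    by (simp add: cong_cform_def)
  moreover have "cong_cform 0 1 (-1) 0 (label_cform (L71 \<alpha>)) (label_cform (L71 (-\<alpha>)))" for \<alpha>
    by (simp add: cong_cform_def)
  ultimately show ?thesis using assms cform_iso_if_cong unfolding same_class_def by blast
qed

section \<open>The classification\<close>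

theorem theorem2p6:
  fixes scale :: "complex \<Rightarrow> 'a::ab_group_add \<Rightarrow> 'a"
    and mul :: "'a \<Rightarrow> 'a \<Rightarrow> 'a"
  shows
    "(symmetric_leibniz_algebra scale mul
      \<and> vector_space.dim scale (UNIV :: 'a set) = 5
      \<and> complex_algebra.solvable scale mul
      \<and> \<not> complex_algebra.nilpotent scale mul
      \<and> \<not> complex_algebra.split scale mul
      \<and> \<not> complex_algebra.is_lie_algebra mul
      \<and> isomorphic_algebras scale (complex_algebra.bracket scale mul) (*s) lie_G
      \<longrightarrow> (\<exists>p\<in>labels. isomorphic_algebras scale mul (*s) (listed_mul p)))
    \<and> (\<forall>p\<in>labels. \<forall>q\<in>labels.
        isomorphic_algebras (*s) (listed_mul p) (*s) (listed_mul q) \<longleftrightarrow>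
          p = q
          \<or> (\<exists>\<alpha> \<beta>. p = L74 \<alpha> \<beta> \<and> q = L74 (- \<alpha>) (- \<beta>))
          \<or> (\<exists>\<alpha>. p = L71 \<alpha> \<and> q = L71 (- \<alpha>)))"
proof (intro conjI impI ballI)
  assume A: "symmetric_leibniz_algebra scale mul
      \<and> vector_space.dim scale (UNIV :: 'a set) = 5
      \<and> complex_algebra.solvable scale mul
      \<and> \<not> complex_algebra.nilpotent scale mul
      \<and> \<not> complex_algebra.split scale mul
      \<and> \<not> complex_algebra.is_lie_algebra mul
      \<and> isomorphic_algebras scale (complex_algebra.bracket scale mul) (*s) lie_G"
  then have leibniz: "symmetric_leibniz_algebra scale mul"
    and G: "isomorphic_algebras scale (complex_algebra.bracket scale mul) (*s) lie_G"
    and nonsplit: "\<not> complex_algebra.split scale mul"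
    by blast+
  obtain F where F: "isomorphic_algebras scale mul (*s) (cform_mul F)"
    using G_isomorphic_cform_mul[OF leibniz G] by blast
  have "sq2 F \<noteq> 0 \<or> lin3 F \<noteq> 0 \<or> lin4 F \<noteq> 0"
    using split_if_e2_circ_zero[OF symmetric_leibniz_algebra.axioms(1)[OF leibniz] F] nonsplit
    by blast
  then obtain p where "p \<in> labels" "F \<simeq> label_cform p"
    using iso_label by blast
  with F show "\<exists>p\<in>labels. isomorphic_algebras scale mul (*s) (listed_mul p)"
    unfolding listed_mul_eq by (blast intro: isomorphic_algebras_trans)
next
  fix p q
  assume "p \<in> labels" "q \<in> labels"
  then show "isomorphic_algebras (*s) (listed_mul p) (*s) (listed_mul q) \<longleftrightarrow>
      p = q
      \<or> (\<exists>\<alpha> \<beta>. p = L74 \<alpha> \<beta> \<and> q = L74 (- \<alpha>) (- \<beta>))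
      \<or> (\<exists>\<alpha>. p = L71 \<alpha> \<and> q = L71 (- \<alpha>))"
    unfolding listed_mul_eq same_class_def[symmetric]
    using same_class_if_iso iso_if_same_class by blast
qed

end
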